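(* Let $X$ be a complex Banach space. Then the function $$\Theta\colon\mathcal M(\mathcal A_u(B_X))\to\mathcal M(\mathcal{H}L(B_X)),\qquad \xi\mapsto\xi|_{\mathcal{H}L(B_X)},$$ is bijective.
   Context: $B_X$ denotes the open unit ball of $X$. $\mathcal{H}L(B_X)$ is the space of all holomorphic Lipschitz functions $f\colon B_X\to\mathbb C$ with the norm $\|f\|_L=L(f)+|f(0)|$, where $L(f)$ is the Lipschitz constant; it is a unital algebra under pointwise product with $\|fg\|_L\le2\|f\|_L\|g\|_L$. $\mathcal A_u(B_X)$ is the Banach algebra of holomorphic uniformly continuous functions $B_X\to\mathbb C$ with the supremum norm; $\mathcal{H}L(B_X)\subseteq\mathcal A_u(B_X)$, and the inclusion has norm one. For $\mathcal A$ equal to either algebra, $\mathcal M(\mathcal A)=\{\varphi\in\mathcal A^*:\varphi\text{ is multiplicative}\}\setminus\{0\}$ is its spectrum, where multiplicative means $\varphi(fg)=\varphi(f)\varphi(g)$ for all $f,g\in\mathcal A$. *)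

theory Defs
  imports "HOL-Analysis.Analysis" "HOL-Library.FuncSet"
begin

class scaleC = scaleR +
  fixes scaleC :: "complex \<Rightarrow> 'a \<Rightarrow> 'a" (infixr "*\<^sub>C" 75)

class complex_normed_vector = real_normed_vector + scaleC +
  assumes scaleC_add_right: "a *\<^sub>C (x + y) = a *\<^sub>C x + a *\<^sub>C y"
    and scaleC_add_left: "(a + b) *\<^sub>C x = a *\<^sub>C x + b *\<^sub>C x"
    and scaleC_scaleC: "a *\<^sub>C (b *\<^sub>C x) = (a * b) *\<^sub>C x"
    and scaleC_of_real: "complex_of_real r *\<^sub>C x = r *\<^sub>R x"
    and norm_scaleC: "norm (a *\<^sub>C x) = cmod a * norm x"

class complex_banach = complex_normed_vector + complete_space
begin
subclass banach ..
end

instantiation complex :: complex_banach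
begin

definition scaleC_complex :: "complex \<Rightarrow> complex \<Rightarrow> complex" where
  "scaleC_complex a x = a * x"

instance
  by standard (simp_all add: scaleC_complex_def algebra_simps norm_mult scaleR_conv_of_real)

end

abbreviation unit_ball :: "'a::complex_banach set" where
  "unit_ball \<equiv> ball 0 1"

text \<open>Complex Frechet differentiability at every point; only meaningful for open \<open>U\<close>.\<close>

definition holo_on :: "('a::complex_banach \<Rightarrow> complex) \<Rightarrow> 'a set \<Rightarrow> bool" where
  "holo_on f U \<longleftrightarrow>
     (\<forall>x\<in>U. \<exists>D. (f has_derivative D) (at x) \<and> (\<forall>c v. D (c *\<^sub>C v) = c * D v))"

text \<open>A function on the open unit ball is represented by its extension by zero to the whole
  space, so that equality of functions on the ball is equality in HOL and the representatives
  are closed under pointwise operations.\<close>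

definition ball_funs :: "('a::complex_banach \<Rightarrow> complex) set" where
  "ball_funs = {f. \<forall>x. x \<notin> unit_ball \<longrightarrow> f x = 0}"

definition HL :: "('a::complex_banach \<Rightarrow> complex) set" where
  "HL = {f \<in> ball_funs. holo_on f unit_ball \<and> (\<exists>C. C-lipschitz_on unit_ball f)}"

definition lip_const :: "('a::complex_banach \<Rightarrow> complex) \<Rightarrow> real" where
  "lip_const f = Inf {C. C-lipschitz_on unit_ball f}"

definition lip_norm :: "('a::complex_banach \<Rightarrow> complex) \<Rightarrow> real" where
  "lip_norm f = lip_const f + cmod (f 0)"

definition Au :: "('a::complex_banach \<Rightarrow> complex) set" where
  "Au = {f \<in> ball_funs. holo_on f unit_ball \<and> uniformly_continuous_on unit_ball f}"

definition sup_norm :: "('a::complex_banach \<Rightarrow> complex) \<Rightarrow> real" where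
  "sup_norm f = (SUP x\<in>unit_ball. cmod (f x))"

text \<open>The topological dual of a function space \<open>A\<close> normed by \<open>N\<close>. Functionals are
  extensional (\<open>undefined\<close> off \<open>A\<close>), so that two of them are equal iff they agree on \<open>A\<close>.\<close>

definition dual ::
  "('a \<Rightarrow> complex) set \<Rightarrow> (('a \<Rightarrow> complex) \<Rightarrow> real) \<Rightarrow> (('a \<Rightarrow> complex) \<Rightarrow> complex) set" where
  "dual A N = {\<phi> \<in> extensional A.
     (\<forall>f\<in>A. \<forall>g\<in>A. \<phi> (\<lambda>x. f x + g x) = \<phi> f + \<phi> g) \<and>
     (\<forall>c. \<forall>f\<in>A. \<phi> (\<lambda>x. c * f x) = c * \<phi> f) \<and>
     (\<exists>K. \<forall>f\<in>A. cmod (\<phi> f) \<le> K * N f)}"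

definition spectrum ::
  "('a \<Rightarrow> complex) set \<Rightarrow> (('a \<Rightarrow> complex) \<Rightarrow> real) \<Rightarrow> (('a \<Rightarrow> complex) \<Rightarrow> complex) set" where
  "spectrum A N =
     {\<phi> \<in> dual A N. \<forall>f\<in>A. \<forall>g\<in>A. \<phi> (\<lambda>x. f x * g x) = \<phi> f * \<phi> g} - {\<lambda>f\<in>A. 0}"

lemma HL_subset_Au: "HL \<subseteq> Au"
  by (auto simp: HL_def Au_def lipschitz_on_uniformly_continuous)

end

theory Submission
  imports Defs "HOL-Complex_Analysis.Cauchy_Integral_Formula"
begin

text \<open>
  Two facts carry the proof. The first is that the holomorphic Lipschitz functions are dense in
  \<open>Au\<close>: a function \<open>f\<close> in \<open>Au\<close> is the uniform limit on the ball of its shrinkings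
  \<open>x \<mapsto> f (r x)\<close>, \<open>r < 1\<close>, because \<open>f\<close> is uniformly continuous, and each
  shrinking is Lipschitz, because \<open>f\<close> is bounded and Cauchy's inequality on complex discs then
  bounds its derivative on \<open>r B\<close> (\<open>HL_shrink\<close>, \<open>uniform_limit_shrink\<close>). The second
  is that a multiplicative functional \<open>\<phi>\<close> on \<open>HL\<close>, although bounded only for the
  Lipschitz norm, is a contraction for the supremum norm (\<open>spectrum_HL_contractive\<close>): if
  \<open>\<bar>g\<bar> \<le> 1\<close>, the Lipschitz norm of \<open>g ^ n\<close> grows at most linearly in \<open>n\<close>,
  whereas \<open>\<phi> (g ^ n) = (\<phi> g) ^ n\<close> would grow exponentially if \<open>\<bar>\<phi> g\<bar> > 1\<close>.

  A character of \<open>Au\<close> is therefore determined by its values on \<open>HL\<close>. Conversely, a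
  character \<open>\<phi>\<close> of \<open>HL\<close> extends by continuity; as shrinking is an algebra homomorphism,
  the formula \<open>\<xi> f = lim (\<phi> (shrink n f))\<close> makes it immediate that the extension is again
  linear and multiplicative.
\<close>

section \<open>The two function algebras\<close>

lemma holo_on_add:
  assumes "holo_on f U" "holo_on g U"
  shows "holo_on (\<lambda>x. f x + g x) U"
  unfolding holo_on_def
proof
  fix x assume "x \<in> U"
  then obtain D E where "(f has_derivative D) (at x)" "\<forall>c v. D (c *\<^sub>C v) = c * D v"
    and "(g has_derivative E) (at x)" "\<forall>c v. E (c *\<^sub>C v) = c * E v"
    using assms unfolding holo_on_def by meson
  then show "\<exists>D. ((\<lambda>x. f x + g x) has_derivative D) (at x) \<and> (\<forall>c v. D (c *\<^sub>C v) = c * D v)"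
    by (intro exI[of _ "\<lambda>v. D v + E v"] conjI has_derivative_add) (auto simp: algebra_simps)
qed

lemma holo_on_mult:
  assumes "holo_on f U" "holo_on g U"
  shows "holo_on (\<lambda>x. f x * g x) U"
  unfolding holo_on_def
proof
  fix x assume "x \<in> U"
  then obtain D E where "(f has_derivative D) (at x)" "\<forall>c v. D (c *\<^sub>C v) = c * D v"
    and "(g has_derivative E) (at x)" "\<forall>c v. E (c *\<^sub>C v) = c * E v"
    using assms unfolding holo_on_def by meson
  then show "\<exists>D. ((\<lambda>x. f x * g x) has_derivative D) (at x) \<and> (\<forall>c v. D (c *\<^sub>C v) = c * D v)"
    by (intro exI[of _ "\<lambda>v. f x * E v + D v * g x"] conjI has_derivative_mult)
      (auto simp: algebra_simps)
qed

lemma holo_on_const: "holo_on (\<lambda>x. c) U"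
  unfolding holo_on_def by (auto intro!: exI[of _ "\<lambda>v. 0"])

text \<open>The ball of an infinite-dimensional space is not totally bounded, so boundedness has to come
  from its convexity: the segment from \<open>0\<close> to a point of the ball is crossed in a fixed number of
  equal steps, each changing \<open>f\<close> by less than \<open>1\<close>.\<close>

lemma Au_bounded:
  assumes f: "f \<in> Au"
  obtains M where "0 < M" "\<And>x. cmod (f x) \<le> M"
proof -
  have "uniformly_continuous_on unit_ball f" using f by (simp add: Au_def)
  then obtain d where d: "d > 0"
    "\<And>x y. x \<in> unit_ball \<Longrightarrow> y \<in> unit_ball \<Longrightarrow> dist y x < d \<Longrightarrow> dist (f y) (f x) < 1"
    unfolding uniformly_continuous_on_def by (metis zero_less_one)
  obtain N where N: "inverse (real (Suc N)) < d"
    using reals_Archimedean[OF d(1)] by blast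
  let ?p = "\<lambda>k x. (real k / real (Suc N)) *\<^sub>R x"
  have step: "cmod (f (?p k x)) \<le> cmod (f 0) + real k" if "x \<in> unit_ball" "k \<le> Suc N" for x k
    using that(2)
  proof (induction k)
    case 0
    then show ?case by simp
  next
    case (Suc k)
    have inb: "?p j x \<in> unit_ball" if "j \<le> Suc N" for j
    proof -
      have "real j / real (Suc N) * norm x \<le> 1 * norm x"
        using that by (intro mult_right_mono) auto
      moreover have "norm (?p j x) = real j / real (Suc N) * norm x" by simp
      moreover have "norm x < 1" using \<open>x \<in> unit_ball\<close> by simp
      ultimately have "norm (?p j x) < 1" by linarith
      then show ?thesis unfolding mem_ball_0 .
    qed
    have "?p (Suc k) x - ?p k x = inverse (real (Suc N)) *\<^sub>R x"
      by (simp add: scaleR_left_diff_distrib[symmetric] field_simps)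
    then have "dist (?p (Suc k) x) (?p k x) = inverse (real (Suc N)) * norm x"
      by (simp add: dist_norm)
    also have "\<dots> \<le> inverse (real (Suc N)) * 1"
      using \<open>x \<in> unit_ball\<close> by (intro mult_left_mono) auto
    finally have "dist (?p (Suc k) x) (?p k x) < d" using N by simp
    then have "dist (f (?p (Suc k) x)) (f (?p k x)) < 1"
      using Suc.prems by (intro d(2) inb) auto
    then have "cmod (f (?p (Suc k) x)) \<le> cmod (f (?p k x)) + 1"
      unfolding dist_norm by (smt (verit) norm_triangle_ineq2)
    then show ?case using Suc by simp
  qed
  have "cmod (f x) \<le> cmod (f 0) + real (Suc N)" for x
  proof (cases "x \<in> unit_ball")
    case True
    then show ?thesis using step[of x "Suc N"] by simp
  next
    case False
    then have "f x = 0" using f by (auto simp: Au_def ball_funs_def)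
    then show ?thesis by simp
  qed
  then show thesis using that[of "cmod (f 0) + real (Suc N)"] by (simp add: add_nonneg_pos)
qed

lemma norm_mult_diff_le:
  fixes a b c d :: complex
  assumes "cmod a \<le> M" "cmod d \<le> N"
  shows "cmod (a * b - c * d) \<le> M * cmod (b - d) + N * cmod (a - c)"
proof -
  have "a * b - c * d = a * (b - d) + (a - c) * d" by (simp add: algebra_simps)
  also have "cmod \<dots> \<le> cmod a * cmod (b - d) + cmod (a - c) * cmod d"
    by (metis norm_mult norm_triangle_ineq)
  also have "\<dots> \<le> M * cmod (b - d) + cmod (a - c) * N"
    using assms by (intro add_mono mult_right_mono mult_left_mono) auto
  finally show ?thesis by (simp add: mult.commute)
qed

lemma Au_add: "f \<in> Au \<Longrightarrow> g \<in> Au \<Longrightarrow> (\<lambda>x. f x + g x) \<in> Au"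
  by (auto simp: Au_def ball_funs_def intro!: holo_on_add uniformly_continuous_on_add)

lemma Au_cmult: "f \<in> Au \<Longrightarrow> (\<lambda>x. c * f x) \<in> Au"
  by (auto simp: Au_def ball_funs_def
      intro!: holo_on_mult holo_on_const uniformly_continuous_on_cmul_left)

lemma Au_mult:
  assumes f: "f \<in> Au" and g: "g \<in> Au"
  shows "(\<lambda>x. f x * g x) \<in> Au"
proof -
  obtain M where M: "0 < M" "\<And>x. cmod (f x) \<le> M" using Au_bounded[OF f] by blast
  obtain N where N: "0 < N" "\<And>x. cmod (g x) \<le> N" using Au_bounded[OF g] by blast
  have "uniformly_continuous_on unit_ball (\<lambda>x. f x * g x)"
    unfolding uniformly_continuous_on_def
  proof (intro allI impI)
    fix e :: real assume "e > 0"
    then have e: "e / (2 * M) > 0" "e / (2 * N) > 0" using M(1) N(1) by auto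
    obtain d1 where d1: "d1 > 0"
      "\<And>x y. x \<in> unit_ball \<Longrightarrow> y \<in> unit_ball \<Longrightarrow> dist y x < d1 \<Longrightarrow> dist (f y) (f x) < e / (2 * N)"
      using f e(2) unfolding Au_def uniformly_continuous_on_def by blast
    obtain d2 where d2: "d2 > 0"
      "\<And>x y. x \<in> unit_ball \<Longrightarrow> y \<in> unit_ball \<Longrightarrow> dist y x < d2 \<Longrightarrow> dist (g y) (g x) < e / (2 * M)"
      using g e(1) unfolding Au_def uniformly_continuous_on_def by blast
    show "\<exists>d>0. \<forall>x\<in>unit_ball. \<forall>y\<in>unit_ball. dist y x < d \<longrightarrow> dist (f y * g y) (f x * g x) < e"
    proof (intro exI[of _ "min d1 d2"] conjI ballI impI)
      fix x y :: 'a assume xy: "x \<in> unit_ball" "y \<in> unit_ball" "dist y x < min d1 d2"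
      have "M * cmod (g y - g x) < M * (e / (2 * M))" "N * cmod (f y - f x) < N * (e / (2 * N))"
        using d1(2)[OF xy(1,2)] d2(2)[OF xy(1,2)] xy(3) M(1) N(1)
        by (simp_all only: dist_norm[symmetric] min_less_iff_conj mult_less_cancel_left_pos)
      then have "M * cmod (g y - g x) < e / 2" "N * cmod (f y - f x) < e / 2"
        using M(1) N(1) by simp_all
      then show "dist (f y * g y) (f x * g x) < e"
        using norm_mult_diff_le[OF M(2)[of y] N(2)[of x], of "g y" "f x"]
        unfolding dist_norm by linarith
    qed (use d1 d2 in auto)
  qed
  then show ?thesis using f g by (auto simp: Au_def ball_funs_def intro!: holo_on_mult)
qed

lemma HL_in_Au: "f \<in> HL \<Longrightarrow> f \<in> Au"
  using HL_subset_Au by blast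

lemma HL_add: "f \<in> HL \<Longrightarrow> g \<in> HL \<Longrightarrow> (\<lambda>x. f x + g x) \<in> HL"
  by (auto simp: HL_def ball_funs_def intro!: holo_on_add lipschitz_on_add)

lemma HL_mult:
  assumes f: "f \<in> HL" and g: "g \<in> HL"
  shows "(\<lambda>x. f x * g x) \<in> HL"
proof -
  obtain M where M: "0 < M" "\<And>x. cmod (f x) \<le> M" using Au_bounded[OF HL_in_Au[OF f]] by blast
  obtain N where N: "0 < N" "\<And>x. cmod (g x) \<le> N" using Au_bounded[OF HL_in_Au[OF g]] by blast
  obtain C where C: "C-lipschitz_on unit_ball f" using f by (auto simp: HL_def)
  obtain D where D: "D-lipschitz_on unit_ball g" using g by (auto simp: HL_def)
  have "(M * D + N * C)-lipschitz_on unit_ball (\<lambda>x. f x * g x)"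
  proof (rule lipschitz_onI)
    fix x y :: 'a assume xy: "x \<in> unit_ball" "y \<in> unit_ball"
    have "cmod (f x * g x - f y * g y) \<le> M * cmod (g x - g y) + N * cmod (f x - f y)"
      by (rule norm_mult_diff_le[OF M(2) N(2)])
    also have "\<dots> \<le> M * (D * dist x y) + N * (C * dist x y)"
      using lipschitz_onD[OF C xy] lipschitz_onD[OF D xy] M(1) N(1)
      by (intro add_mono mult_left_mono) (auto simp: dist_norm)
    finally show "dist (f x * g x) (f y * g y) \<le> (M * D + N * C) * dist x y"
      by (simp add: dist_norm algebra_simps)
  qed (use M N lipschitz_on_nonneg[OF C] lipschitz_on_nonneg[OF D] in auto)
  then show ?thesis using f g by (auto simp: HL_def ball_funs_def intro!: holo_on_mult)
qed

lemma HL_cmult: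
  assumes "f \<in> HL"
  shows "(\<lambda>x. c * f x) \<in> HL"
proof -
  obtain C where C: "C-lipschitz_on unit_ball f" using assms by (auto simp: HL_def)
  have "(cmod c * C)-lipschitz_on unit_ball (\<lambda>x. c * f x)"
  proof (rule lipschitz_onI)
    fix x y :: 'a assume xy: "x \<in> unit_ball" "y \<in> unit_ball"
    have "cmod c * dist (f x) (f y) \<le> cmod c * (C * dist x y)"
      using lipschitz_onD[OF C xy] by (intro mult_left_mono) auto
    then show "dist (c * f x) (c * f y) \<le> cmod c * C * dist x y"
      by (simp add: dist_norm right_diff_distrib[symmetric] norm_mult mult.assoc)
  qed (use lipschitz_on_nonneg[OF C] in auto)
  then show ?thesis using assms by (auto simp: HL_def ball_funs_def intro!: holo_on_mult holo_on_const)
qed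

text \<open>The exponent is a successor because the constant \<open>g ^ 0\<close> does not vanish off the ball.\<close>

lemma HL_power: "g \<in> HL \<Longrightarrow> (\<lambda>x. g x ^ Suc n) \<in> HL"
proof (induction n)
  case (Suc n)
  then show ?case using HL_mult[of g "\<lambda>x. g x ^ Suc n"] by simp
qed simp

section \<open>The norms\<close>

lemma norm_le_sup_norm:
  assumes "f \<in> Au" "x \<in> unit_ball"
  shows "cmod (f x) \<le> sup_norm f"
  unfolding sup_norm_def
proof (rule cSUP_upper[OF assms(2)])
  obtain M where "\<And>x. cmod (f x) \<le> M" using Au_bounded[OF assms(1)] by blast
  then show "bdd_above ((\<lambda>x. cmod (f x)) ` unit_ball)" by (auto simp: bdd_above_def)
qed

lemma sup_norm_le: "(\<And>x. x \<in> unit_ball \<Longrightarrow> cmod (f x) \<le> M) \<Longrightarrow> sup_norm f \<le> M"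
  unfolding sup_norm_def by (rule cSUP_least) auto

lemma lip_const_le: "C-lipschitz_on unit_ball f \<Longrightarrow> lip_const f \<le> C"
  unfolding lip_const_def
  by (rule cInf_lower) (auto simp: bdd_below_def dest: lipschitz_on_nonneg intro!: exI[of _ 0])

lemma norm_le_lip_norm:
  assumes "f \<in> HL" "x \<in> unit_ball"
  shows "cmod (f x) \<le> lip_norm f"
proof -
  have "cmod (f x) - cmod (f 0) \<le> lip_const f"
    unfolding lip_const_def
  proof (rule cInf_greatest)
    show "{C. C-lipschitz_on unit_ball f} \<noteq> {}" using assms by (auto simp: HL_def)
    fix C assume "C \<in> {C. C-lipschitz_on unit_ball f}"
    then have C: "C-lipschitz_on unit_ball f" by simp
    have "cmod (f x) - cmod (f 0) \<le> dist (f x) (f 0)"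
      by (simp add: dist_norm norm_triangle_ineq2)
    also have "\<dots> \<le> C * dist x 0" by (rule lipschitz_onD[OF C]) (use assms in auto)
    also have "\<dots> \<le> C * 1"
      using lipschitz_on_nonneg[OF C] assms by (intro mult_left_mono) auto
    finally show "cmod (f x) - cmod (f 0) \<le> C" by simp
  qed
  then show ?thesis by (simp add: lip_norm_def)
qed

section \<open>Shrinking the argument\<close>

text \<open>The case distinction keeps the representative zero off the ball, where \<open>f\<close> at the shrunk point
  need not vanish.\<close>

definition shrink :: "nat \<Rightarrow> ('a::complex_banach \<Rightarrow> complex) \<Rightarrow> 'a \<Rightarrow> complex" where
  "shrink n f = (\<lambda>x. if x \<in> unit_ball then f ((real n / real (Suc n)) *\<^sub>R x) else 0)"

lemma shrink_add: "shrink n (\<lambda>x. f x + g x) = (\<lambda>x. shrink n f x + shrink n g x)"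
  by (auto simp: shrink_def)

lemma shrink_cmult: "shrink n (\<lambda>x. c * f x) = (\<lambda>x. c * shrink n f x)"
  by (auto simp: shrink_def)

lemma shrink_mult: "shrink n (\<lambda>x. f x * g x) = (\<lambda>x. shrink n f x * shrink n g x)"
  by (auto simp: shrink_def)

lemma shrunk_norm_le:
  assumes "x \<in> unit_ball"
  shows "norm ((real n / real (Suc n)) *\<^sub>R x) \<le> real n / real (Suc n)"
    and "(real n / real (Suc n)) *\<^sub>R x \<in> unit_ball"
proof -
  have "real n / real (Suc n) * norm x \<le> real n / real (Suc n) * 1"
    using assms by (intro mult_left_mono) auto
  then show *: "norm ((real n / real (Suc n)) *\<^sub>R x) \<le> real n / real (Suc n)" by simp
  have "real n / real (Suc n) < 1" by simp
  with * show "(real n / real (Suc n)) *\<^sub>R x \<in> unit_ball"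
    unfolding mem_ball_0 by (rule order_le_less_trans)
qed

lemma uniform_limit_shrink:
  assumes f: "f \<in> Au"
  shows "uniform_limit unit_ball (\<lambda>n. shrink n f) f sequentially"
  unfolding uniform_limit_sequentially_iff
proof (intro allI impI)
  fix e :: real assume "e > 0"
  then obtain d where d: "d > 0"
    "\<And>x y. x \<in> unit_ball \<Longrightarrow> y \<in> unit_ball \<Longrightarrow> dist y x < d \<Longrightarrow> dist (f y) (f x) < e"
    using f unfolding Au_def uniformly_continuous_on_def by blast
  obtain N where N: "inverse (real (Suc N)) < d"
    using reals_Archimedean[OF d(1)] by blast
  show "\<exists>N. \<forall>n\<ge>N. \<forall>x\<in>unit_ball. dist (shrink n f x) (f x) < e"
  proof (intro exI[of _ N] allI ballI impI)
    fix n and x :: 'a assume n: "n \<ge> N" and x: "x \<in> unit_ball"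
    have "(real n / real (Suc n)) *\<^sub>R x - x = (real n / real (Suc n) - 1) *\<^sub>R x"
      by (simp add: scaleR_left_diff_distrib)
    also have "real n / real (Suc n) - 1 = - inverse (real (Suc n))"
      by (simp add: field_simps)
    finally have "dist ((real n / real (Suc n)) *\<^sub>R x) x = inverse (real (Suc n)) * norm x"
      by (simp add: dist_norm)
    also have "\<dots> \<le> inverse (real (Suc n)) * 1"
      using x by (intro mult_left_mono) auto
    also have "\<dots> \<le> inverse (real (Suc N))" using n by (simp add: field_simps)
    finally have "dist ((real n / real (Suc n)) *\<^sub>R x) x < d" using N by simp
    then show "dist (shrink n f x) (f x) < e"
      using d(2)[OF x shrunk_norm_le(2)[OF x]] x by (simp add: shrink_def)
  qed
qed

text \<open>Along the complex line through \<open>x\<close> in a unit direction \<open>v\<close>, \<open>f\<close> is a holomorphic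
  function of one variable on the disc of radius \<open>1 - r\<close>, with derivative \<open>D v\<close> at the centre, and
  Cauchy's inequality applies. Halving the radius makes the closed disc lie inside the ball, at the
  price of the factor \<open>2\<close>.\<close>

lemma derivative_bound_of_bounded_holo:
  fixes f :: "'a::complex_banach \<Rightarrow> complex"
  assumes holo: "holo_on f unit_ball" and M: "0 \<le> M" "\<And>x. x \<in> unit_ball \<Longrightarrow> cmod (f x) \<le> M"
    and x: "norm x \<le> r" "r < 1"
    and D: "(f has_derivative D) (at x)" "\<And>c v. D (c *\<^sub>C v) = c * D v"
  shows "cmod (D v) \<le> 2 * M / (1 - r) * norm v"
proof (cases "v = 0")
  case True
  then have "D v = 0" using linear_0[OF has_derivative_linear[OF D(1)]] by simp
  then show ?thesis using True by simp
next
  case False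
  then have nv: "norm v > 0" by simp
  define \<rho> where "\<rho> = (1 - r) / 2 / norm v"
  have \<rho>: "\<rho> > 0" using x nv by (simp add: \<rho>_def)
  define h where "h = (\<lambda>z. f (x + z *\<^sub>C v))"
  have line_in: "x + z *\<^sub>C v \<in> unit_ball" if "cmod z \<le> \<rho>" for z
  proof -
    have "norm (x + z *\<^sub>C v) \<le> norm x + cmod z * norm v"
      using norm_triangle_ineq[of x "z *\<^sub>C v"] by (simp add: norm_scaleC)
    also have "\<dots> \<le> r + \<rho> * norm v"
      using that x by (intro add_mono mult_right_mono) auto
    also have "\<dots> < 1" using nv x by (simp add: \<rho>_def field_simps)
    finally show ?thesis by simp
  qed
  have "bounded_linear (\<lambda>z. z *\<^sub>C v)"
  proof (rule bounded_linear_intro[where K = "norm v"])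
    show "(s *\<^sub>R z) *\<^sub>C v = s *\<^sub>R (z *\<^sub>C v)" for s :: real and z
      by (metis scaleC_of_real scaleC_scaleC scaleR_conv_of_real)
  qed (auto simp: scaleC_add_left norm_scaleC)
  then have line: "((\<lambda>z. x + z *\<^sub>C v) has_derivative (\<lambda>z. z *\<^sub>C v)) (at z)" for z
    by (auto intro!: derivative_eq_intros bounded_linear_imp_has_derivative)
  have chain: "(h has_field_derivative E v) (at z)"
    if "(f has_derivative E) (at (x + z *\<^sub>C v))" "\<And>c v. E (c *\<^sub>C v) = c * E v" for E z
    using has_derivative_compose[OF line that(1)] that(2)
    by (simp add: h_def has_field_derivative_def mult_commute_abs)
  have diff: "h field_differentiable (at z)" if "cmod z \<le> \<rho>" for z
    using holo line_in[OF that] chain unfolding holo_on_def field_differentiable_def by metis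
  have "(h has_field_derivative D v) (at 0)"
    using D by (intro chain) (metis add.right_neutral mult_zero_left norm_eq_zero norm_scaleC norm_zero)+
  then have "D v = deriv h 0" by (simp add: DERIV_imp_deriv)
  moreover have "cmod ((deriv ^^ 1) h 0) \<le> fact 1 * M / \<rho> ^ 1"
  proof (rule Cauchy_inequality[OF _ _ \<rho>])
    show "h holomorphic_on ball 0 \<rho>"
      unfolding holomorphic_on_def
      by (auto intro!: field_differentiable_at_within diff)
    show "continuous_on (cball 0 \<rho>) h"
      by (auto intro!: continuous_at_imp_continuous_on field_differentiable_imp_continuous_at diff)
    show "cmod (h z) \<le> M" if "cmod (0 - z) = \<rho>" for z
      using that unfolding h_def by (intro M(2) line_in) simp
  qed
  ultimately have "cmod (D v) \<le> M / \<rho>" by simp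
  also have "\<dots> = 2 * M / (1 - r) * norm v" using nv x by (simp add: \<rho>_def field_simps)
  finally show ?thesis .
qed

lemma holo_on_shrink:
  assumes holo: "holo_on f unit_ball"
  shows "holo_on (shrink n f) unit_ball"
  unfolding holo_on_def
proof
  fix x :: 'a assume x: "x \<in> unit_ball"
  let ?r = "real n / real (Suc n)"
  obtain D where D: "(f has_derivative D) (at (?r *\<^sub>R x))" "\<And>c v. D (c *\<^sub>C v) = c * D v"
    using holo shrunk_norm_le(2)[OF x] unfolding holo_on_def by meson
  have "((\<lambda>x. ?r *\<^sub>R x) has_derivative (\<lambda>v. ?r *\<^sub>R v)) (at x)"
    by (auto intro!: derivative_eq_intros)
  then have "((\<lambda>x. f (?r *\<^sub>R x)) has_derivative (\<lambda>v. D (?r *\<^sub>R v))) (at x)"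
    using D(1) by (rule has_derivative_compose)
  then have "(shrink n f has_derivative (\<lambda>v. D (?r *\<^sub>R v))) (at x)"
    by (rule has_derivative_transform_within_open[where s = unit_ball]) (use x in \<open>auto simp: shrink_def\<close>)
  moreover have "D (?r *\<^sub>R (c *\<^sub>C v)) = c * D (?r *\<^sub>R v)" for c v
    unfolding D(2)[symmetric] scaleC_of_real[symmetric] scaleC_scaleC by (simp only: mult.commute)
  ultimately show "\<exists>D. (shrink n f has_derivative D) (at x) \<and> (\<forall>c v. D (c *\<^sub>C v) = c * D v)"
    by blast
qed

lemma HL_shrink:
  assumes f: "f \<in> Au"
  shows "shrink n f \<in> HL"
proof -
  let ?r = "real n / real (Suc n)"
  have r: "0 \<le> ?r" "?r < 1" by auto
  have holo: "holo_on f unit_ball" using f by (simp add: Au_def)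
  obtain M where M: "0 < M" "\<And>x. cmod (f x) \<le> M" using Au_bounded[OF f] by blast
  define C where "C = 2 * M / (1 - ?r)"
  have C: "C \<ge> 0" using M r unfolding C_def by (intro divide_nonneg_nonneg) auto
  have lip: "C-lipschitz_on (cball 0 ?r) f"
  proof (rule lipschitz_onI[OF _ C])
    obtain D where D: "\<And>x. x \<in> unit_ball \<Longrightarrow> (f has_derivative D x) (at x)"
      "\<And>x c v. x \<in> unit_ball \<Longrightarrow> D x (c *\<^sub>C v) = c * D x v"
      using holo unfolding holo_on_def by metis
    fix x y :: 'a assume xy: "x \<in> cball 0 ?r" "y \<in> cball 0 ?r"
    have "norm (f x - f y) \<le> C * norm (x - y)"
    proof (rule differentiable_bound[OF convex_cball _ _ xy])
      fix z :: 'a assume "z \<in> cball 0 ?r"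
      then have z: "norm z \<le> ?r" by simp
      then have zb: "z \<in> unit_ball" using r by (simp add: order_le_less_trans)
      show "(f has_derivative D z) (at z within cball 0 ?r)"
        using D(1)[OF zb] by (rule has_derivative_at_withinI)
      show "onorm (D z) \<le> C"
        unfolding C_def using M
        by (intro onorm_bound[OF C[unfolded C_def]]
            derivative_bound_of_bounded_holo[OF holo _ _ z r(2) D(1)[OF zb] D(2)[OF zb]]) auto
    qed
    then show "dist (f x) (f y) \<le> C * dist x y" by (simp add: dist_norm)
  qed
  have "C-lipschitz_on unit_ball (shrink n f)"
  proof (rule lipschitz_onI[OF _ C])
    fix x y :: 'a assume xy: "x \<in> unit_ball" "y \<in> unit_ball"
    have "dist (f (?r *\<^sub>R x)) (f (?r *\<^sub>R y)) \<le> C * dist (?r *\<^sub>R x) (?r *\<^sub>R y)"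
      using shrunk_norm_le(1)[OF xy(1), of n] shrunk_norm_le(1)[OF xy(2), of n]
      by (intro lipschitz_onD[OF lip]) (simp_all del: norm_scaleR)
    also have "dist (?r *\<^sub>R x) (?r *\<^sub>R y) = ?r * dist x y"
      using r by (simp add: dist_norm scaleR_right_diff_distrib[symmetric] del: of_nat_Suc)
    also have "C * (?r * dist x y) \<le> C * (1 * dist x y)"
      using r C by (intro mult_left_mono mult_right_mono) auto
    finally show "dist (shrink n f x) (shrink n f y) \<le> C * dist x y"
      using xy by (simp add: shrink_def)
  qed
  then show ?thesis
    using holo_on_shrink[OF holo] by (auto simp: HL_def ball_funs_def shrink_def)
qed

section \<open>Functionals bounded for the supremum norm\<close>

text \<open>Used with \<open>A = Au\<close> for a given character, and with \<open>A = HL\<close> for a character that is known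
  to be continuous only for the Lipschitz norm until \<open>spectrum_HL_contractive\<close> is proved. The
  bound is phrased with upper bounds \<open>M\<close> of \<open>\<bar>f\<bar>\<close> on the ball, which avoids suprema;
  taking \<open>M > 0\<close> allows division by \<open>M\<close>.\<close>

locale sup_bounded_functional =
  fixes A :: "('a::complex_banach \<Rightarrow> complex) set" and \<phi> :: "('a \<Rightarrow> complex) \<Rightarrow> complex" and K :: real
  assumes A_add: "f \<in> A \<Longrightarrow> g \<in> A \<Longrightarrow> (\<lambda>x. f x + g x) \<in> A"
    and A_cmult: "f \<in> A \<Longrightarrow> (\<lambda>x. c * f x) \<in> A"
    and add: "f \<in> A \<Longrightarrow> g \<in> A \<Longrightarrow> \<phi> (\<lambda>x. f x + g x) = \<phi> f + \<phi> g"
    and cmult: "f \<in> A \<Longrightarrow> \<phi> (\<lambda>x. c * f x) = c * \<phi> f"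
    and bound: "f \<in> A \<Longrightarrow> 0 < M \<Longrightarrow> (\<And>x. x \<in> unit_ball \<Longrightarrow> cmod (f x) \<le> M) \<Longrightarrow> cmod (\<phi> f) \<le> K * M"
begin

lemma diff_bound:
  assumes "f \<in> A" "g \<in> A" "0 < M" "\<And>x. x \<in> unit_ball \<Longrightarrow> dist (f x) (g x) \<le> M"
  shows "dist (\<phi> f) (\<phi> g) \<le> K * M"
proof -
  have ng: "(\<lambda>x. - 1 * g x) \<in> A" by (rule A_cmult[OF assms(2)])
  have "\<phi> (\<lambda>x. f x + - 1 * g x) = \<phi> f + - 1 * \<phi> g"
    by (simp only: add[OF assms(1) ng] cmult[OF assms(2)])
  moreover have "cmod (\<phi> (\<lambda>x. f x + - 1 * g x)) \<le> K * M"
    by (rule bound[OF A_add[OF assms(1) ng] assms(3)]) (use assms(4) in \<open>simp add: dist_norm\<close>)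
  ultimately show ?thesis by (simp add: dist_norm)
qed

text \<open>Half of \<open>M\<close>, so that two members of the sequence, both compared with \<open>f\<close>, differ by at
  most \<open>M\<close>.\<close>

lemma uniform_limit_eventually_bound:
  assumes "uniform_limit unit_ball F f sequentially" and "e > 0"
  obtains M N where "0 < M" "K * M < e"
    "\<And>n x. N \<le> n \<Longrightarrow> x \<in> unit_ball \<Longrightarrow> dist (F n x) (f x) < M / 2"
proof -
  define M where "M = e / (\<bar>K\<bar> + 1)"
  have M: "0 < M" using assms(2) by (simp add: M_def add_nonneg_pos)
  have "K * M < (\<bar>K\<bar> + 1) * M" using M by (intro mult_strict_right_mono) auto
  also have "\<dots> = e" by (simp add: M_def)
  finally have KM: "K * M < e" .
  have "M / 2 > 0" using M by simp
  then obtain N where "\<forall>n\<ge>N. \<forall>x\<in>unit_ball. dist (F n x) (f x) < M / 2"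
    using assms(1) unfolding uniform_limit_sequentially_iff by blast
  then show thesis using that[OF M KM] by blast
qed

text \<open>The limit \<open>f\<close> may lie outside \<open>A\<close>: this is what permits extending \<open>\<phi>\<close>.\<close>

lemma Cauchy_of_uniform_limit:
  assumes F: "\<And>n. F n \<in> A" and lim: "uniform_limit unit_ball F f sequentially"
  shows "Cauchy (\<lambda>n. \<phi> (F n))"
proof (rule metric_CauchyI)
  fix e :: real assume "0 < e"
  then obtain M N where M: "0 < M" "K * M < e"
    and N: "\<And>n x. N \<le> n \<Longrightarrow> x \<in> unit_ball \<Longrightarrow> dist (F n x) (f x) < M / 2"
    using uniform_limit_eventually_bound[OF lim] by metis
  have "dist (\<phi> (F m)) (\<phi> (F n)) < e" if mn: "N \<le> m" "N \<le> n" for m n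
  proof -
    have "dist (F m x) (F n x) \<le> M" if "x \<in> unit_ball" for x
      using N[OF mn(1) that] N[OF mn(2) that] dist_triangle2[of "F m x" "F n x" "f x"] by linarith
    from diff_bound[OF F F M(1) this] M(2) show ?thesis by force
  qed
  then show "\<exists>N. \<forall>m\<ge>N. \<forall>n\<ge>N. dist (\<phi> (F m)) (\<phi> (F n)) < e" by blast
qed

lemma tendsto_of_uniform_limit:
  assumes F: "\<And>n. F n \<in> A" and lim: "uniform_limit unit_ball F f sequentially" and f: "f \<in> A"
  shows "(\<lambda>n. \<phi> (F n)) \<longlonglongrightarrow> \<phi> f"
proof (rule metric_LIMSEQ_I)
  fix e :: real assume "0 < e"
  then obtain M N where M: "0 < M" "K * M < e"
    and N: "\<And>n x. N \<le> n \<Longrightarrow> x \<in> unit_ball \<Longrightarrow> dist (F n x) (f x) < M / 2"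
    using uniform_limit_eventually_bound[OF lim] by metis
  have "dist (\<phi> (F n)) (\<phi> f) < e" if n: "N \<le> n" for n
  proof -
    have "dist (F n x) (f x) \<le> M" if "x \<in> unit_ball" for x
      using N[OF n that] M(1) by linarith
    from diff_bound[OF F f M(1) this] M(2) show ?thesis by force
  qed
  then show "\<exists>N. \<forall>n\<ge>N. dist (\<phi> (F n)) (\<phi> f) < e" by blast
qed

end

text \<open>Since \<open>N\<close> is an arbitrary real-valued function here, making the constant nonnegative
  requires restricting to \<open>f\<close> with \<open>0 \<le> N f\<close>.\<close>

lemma spectrumD:
  assumes "\<phi> \<in> spectrum A N"
  shows "\<phi> \<in> extensional A" "\<phi> \<noteq> (\<lambda>f\<in>A. 0)"
    "\<And>f g. f \<in> A \<Longrightarrow> g \<in> A \<Longrightarrow> \<phi> (\<lambda>x. f x + g x) = \<phi> f + \<phi> g"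
    "\<And>f c. f \<in> A \<Longrightarrow> \<phi> (\<lambda>x. c * f x) = c * \<phi> f"
    "\<And>f g. f \<in> A \<Longrightarrow> g \<in> A \<Longrightarrow> \<phi> (\<lambda>x. f x * g x) = \<phi> f * \<phi> g"
    "\<exists>K\<ge>0. \<forall>f\<in>A. 0 \<le> N f \<longrightarrow> cmod (\<phi> f) \<le> K * N f"
proof -
  obtain K where K: "\<And>f. f \<in> A \<Longrightarrow> cmod (\<phi> f) \<le> K * N f"
    using assms unfolding spectrum_def dual_def by blast
  have "cmod (\<phi> f) \<le> \<bar>K\<bar> * N f" if "f \<in> A" "0 \<le> N f" for f
    using K[OF that(1)] mult_right_mono[OF abs_ge_self that(2), of K] by linarith
  then show "\<exists>K\<ge>0. \<forall>f\<in>A. 0 \<le> N f \<longrightarrow> cmod (\<phi> f) \<le> K * N f"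
    by (intro exI[of _ "\<bar>K\<bar>"]) auto
qed (use assms in \<open>auto simp: spectrum_def dual_def\<close>)

lemma sup_norm_nonneg: "f \<in> Au \<Longrightarrow> 0 \<le> sup_norm f"
  by (rule order_trans[OF norm_ge_zero norm_le_sup_norm[of f 0]]) auto

lemma lip_norm_nonneg: "f \<in> HL \<Longrightarrow> 0 \<le> lip_norm f"
  by (rule order_trans[OF norm_ge_zero norm_le_lip_norm[of f 0]]) auto

lemma sup_bounded_functional_Au:
  fixes \<xi> :: "('a::complex_banach \<Rightarrow> complex) \<Rightarrow> complex"
  assumes "\<xi> \<in> spectrum Au sup_norm"
  obtains K where "sup_bounded_functional Au \<xi> K"
proof -
  note \<xi> = spectrumD[OF assms]
  obtain K where K: "K \<ge> 0" "\<And>f. f \<in> Au \<Longrightarrow> cmod (\<xi> f) \<le> K * sup_norm f"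
    using \<xi>(6) sup_norm_nonneg by blast
  have "sup_bounded_functional Au \<xi> K"
  proof
    fix f :: "'a \<Rightarrow> complex" and M :: real
    assume f: "f \<in> Au" "\<And>x. x \<in> unit_ball \<Longrightarrow> cmod (f x) \<le> M"
    have "sup_norm f \<le> M" using f(2) by (rule sup_norm_le)
    from mult_left_mono[OF this K(1)] show "cmod (\<xi> f) \<le> K * M"
      using K(2)[OF f(1)] by linarith
  qed (simp_all only: Au_add Au_cmult \<xi>(3,4))
  then show thesis by (rule that)
qed

section \<open>Characters of the Lipschitz algebra\<close>

lemma spectrum_HL_power:
  assumes "\<phi> \<in> spectrum HL N" "g \<in> HL"
  shows "\<phi> (\<lambda>x. g x ^ Suc n) = \<phi> g ^ Suc n"
proof (induction n)
  case (Suc n)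
  then show ?case
    using spectrumD(5)[OF assms(1,2) HL_power[OF assms(2), of n]] by simp
qed simp

lemma lip_norm_power_le:
  assumes C: "C-lipschitz_on unit_ball g" and g: "\<And>x. x \<in> unit_ball \<Longrightarrow> cmod (g x) \<le> 1"
  shows "lip_norm (\<lambda>x. g x ^ n) \<le> real n * C + 1"
proof -
  have "(real n * C)-lipschitz_on unit_ball (\<lambda>x. g x ^ n)"
  proof (rule lipschitz_onI)
    fix x y :: 'a assume xy: "x \<in> unit_ball" "y \<in> unit_ball"
    have "dist (g x ^ n) (g y ^ n) \<le> real n * dist (g x) (g y)"
      unfolding dist_norm by (rule norm_power_diff[OF g[OF xy(1)] g[OF xy(2)]])
    also have "\<dots> \<le> real n * (C * dist x y)"
      by (intro mult_left_mono lipschitz_onD[OF C xy]) auto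
    finally show "dist (g x ^ n) (g y ^ n) \<le> real n * C * dist x y" by (simp add: mult.assoc)
  qed (use lipschitz_on_nonneg[OF C] in auto)
  then have "lip_const (\<lambda>x. g x ^ n) \<le> real n * C" by (rule lip_const_le)
  moreover have "cmod (g 0 ^ n) \<le> 1" using g[of 0] by (simp add: norm_power power_le_one)
  ultimately show ?thesis by (simp add: lip_norm_def)
qed

text \<open>Linear growth of the Lipschitz norm of the powers of \<open>g\<close> rules out exponential growth of the
  powers of \<open>\<phi> g\<close>: dividing the bound on the \<open>n\<close>-th power by \<open>(\<phi> g) ^ n\<close> and letting \<open>n\<close> tend to
  infinity would give \<open>1 \<le> 0\<close>.\<close>

lemma spectrum_HL_le_1:
  assumes \<phi>: "\<phi> \<in> spectrum HL lip_norm" and g: "g \<in> HL"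
    and le1: "\<And>x. x \<in> unit_ball \<Longrightarrow> cmod (g x) \<le> 1"
  shows "cmod (\<phi> g) \<le> 1"
proof (rule ccontr)
  define a where "a = cmod (\<phi> g)"
  assume "\<not> cmod (\<phi> g) \<le> 1"
  then have a: "a > 1" by (simp add: a_def)
  obtain C where C: "C-lipschitz_on unit_ball g" using g by (auto simp: HL_def)
  obtain K where K: "K \<ge> 0" "\<And>f. f \<in> HL \<Longrightarrow> cmod (\<phi> f) \<le> K * lip_norm f"
    using spectrumD(6)[OF \<phi>] lip_norm_nonneg by blast
  have bnd: "1 \<le> K * C * (real (Suc n) / a ^ Suc n) + K * inverse (a ^ Suc n)" for n
  proof -
    have "a ^ Suc n = cmod (\<phi> (\<lambda>x. g x ^ Suc n))"
      by (simp only: spectrum_HL_power[OF \<phi> g] norm_power a_def)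
    also have "\<dots> \<le> K * lip_norm (\<lambda>x. g x ^ Suc n)" by (rule K(2)[OF HL_power[OF g]])
    also have "\<dots> \<le> K * (real (Suc n) * C + 1)"
      by (intro mult_left_mono K(1) lip_norm_power_le[OF C le1])
    finally have "a ^ Suc n / a ^ Suc n \<le> K * (real (Suc n) * C + 1) / a ^ Suc n"
      using a by (intro divide_right_mono) auto
    also have "\<dots> = K * C * (real (Suc n) / a ^ Suc n) + K * inverse (a ^ Suc n)"
      by (simp only: divide_inverse) (simp only: algebra_simps)
    finally show ?thesis using a by simp
  qed
  have "(\<lambda>n. real n / a ^ n) \<longlonglongrightarrow> 0" using lim_n_over_pown[of a] a by simp
  moreover have "(\<lambda>n. inverse (a ^ n)) \<longlonglongrightarrow> 0" using a by (rule LIMSEQ_inverse_realpow_zero)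
  ultimately have "(\<lambda>n. K * C * (real n / a ^ n) + K * inverse (a ^ n)) \<longlonglongrightarrow> K * C * 0 + K * 0"
    by (intro tendsto_intros)
  then have "(\<lambda>n. K * C * (real (Suc n) / a ^ Suc n) + K * inverse (a ^ Suc n)) \<longlonglongrightarrow> K * C * 0 + K * 0"
    by (rule LIMSEQ_Suc)
  then have "(1::real) \<le> K * C * 0 + K * 0"
    by (rule LIMSEQ_le_const) (use bnd in blast)
  then show False by simp
qed

lemma spectrum_HL_contractive:
  assumes \<phi>: "\<phi> \<in> spectrum HL lip_norm" and f: "f \<in> HL"
    and M: "0 < M" "\<And>x. x \<in> unit_ball \<Longrightarrow> cmod (f x) \<le> M"
  shows "cmod (\<phi> f) \<le> M"
proof -
  have "cmod (\<phi> (\<lambda>x. of_real (inverse M) * f x)) \<le> 1"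
  proof (rule spectrum_HL_le_1[OF \<phi> HL_cmult[OF f]])
    show "cmod (of_real (inverse M) * f x) \<le> 1" if "x \<in> unit_ball" for x
      using M(1) M(2)[OF that] by (simp add: norm_mult norm_divide field_simps)
  qed
  then have "inverse M * cmod (\<phi> f) \<le> 1"
    using M(1) unfolding spectrumD(4)[OF \<phi> f] norm_mult by (simp add: norm_inverse)
  then show ?thesis using M(1) by (simp add: field_simps)
qed

lemma sup_bounded_functional_HL:
  fixes \<phi> :: "('a::complex_banach \<Rightarrow> complex) \<Rightarrow> complex"
  assumes \<phi>: "\<phi> \<in> spectrum HL lip_norm"
  shows "sup_bounded_functional HL \<phi> 1"
proof
  fix f :: "'a \<Rightarrow> complex" and M :: real
  assume "f \<in> HL" "0 < M" "\<And>x. x \<in> unit_ball \<Longrightarrow> cmod (f x) \<le> M"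
  then show "cmod (\<phi> f) \<le> 1 * M" using spectrum_HL_contractive[OF \<phi>] by simp
qed (simp_all only: HL_add HL_cmult spectrumD(3,4)[OF \<phi>])

section \<open>Restriction and extension of characters\<close>

lemma spectrum_Au_tendsto_shrink:
  assumes "\<xi> \<in> spectrum Au sup_norm" "f \<in> Au"
  shows "(\<lambda>n. \<xi> (shrink n f)) \<longlonglongrightarrow> \<xi> f"
proof -
  obtain K where K: "sup_bounded_functional Au \<xi> K"
    using sup_bounded_functional_Au[OF assms(1)] by blast
  show ?thesis
    by (rule sup_bounded_functional.tendsto_of_uniform_limit
        [OF K HL_in_Au[OF HL_shrink[OF assms(2)]] uniform_limit_shrink[OF assms(2)] assms(2)])
qed

lemma restrict_in_spectrum_HL:
  fixes \<xi> :: "('a::complex_banach \<Rightarrow> complex) \<Rightarrow> complex"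
  assumes \<xi>: "\<xi> \<in> spectrum Au sup_norm"
  shows "restrict \<xi> HL \<in> spectrum HL lip_norm"
proof -
  note D = spectrumD[OF \<xi>]
  obtain K where K: "K \<ge> 0" "\<And>f. f \<in> Au \<Longrightarrow> cmod (\<xi> f) \<le> K * sup_norm f"
    using D(6) sup_norm_nonneg by blast
  have "cmod (\<xi> f) \<le> K * lip_norm f" if "f \<in> HL" for f
  proof -
    have "sup_norm f \<le> lip_norm f" by (rule sup_norm_le[OF norm_le_lip_norm[OF that]])
    from mult_left_mono[OF this K(1)] K(2)[OF HL_in_Au[OF that]] show ?thesis by linarith
  qed
  moreover have "restrict \<xi> HL \<noteq> (\<lambda>f\<in>HL. 0)"
  proof
    assume "restrict \<xi> HL = (\<lambda>f\<in>HL. 0)"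
    then have zero: "\<xi> g = 0" if "g \<in> HL" for g using that by (metis restrict_apply')
    have "\<xi> f = 0" if f: "f \<in> Au" for f
      using spectrum_Au_tendsto_shrink[OF \<xi> f] by (simp add: zero[OF HL_shrink[OF f]] LIMSEQ_const_iff)
    then have "\<xi> = (\<lambda>f\<in>Au. 0)" using D(1) by (auto simp: extensional_def)
    with D(2) show False ..
  qed
  ultimately show ?thesis
    using D by (auto simp: spectrum_def dual_def HL_add HL_cmult HL_mult HL_in_Au)
qed

lemma inj_on_restrict_HL: "inj_on (\<lambda>\<xi>. restrict \<xi> HL) (spectrum Au sup_norm)"
proof (rule inj_onI)
  fix \<xi> \<eta> :: "('a \<Rightarrow> complex) \<Rightarrow> complex"
  assume \<xi>: "\<xi> \<in> spectrum Au sup_norm" and \<eta>: "\<eta> \<in> spectrum Au sup_norm"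
    and eq: "restrict \<xi> HL = restrict \<eta> HL"
  have HL: "\<xi> g = \<eta> g" if "g \<in> HL" for g using eq that by (metis restrict_apply')
  show "\<xi> = \<eta>"
  proof (rule extensionalityI[OF spectrumD(1)[OF \<xi>] spectrumD(1)[OF \<eta>]])
    fix f :: "'a \<Rightarrow> complex" assume f: "f \<in> Au"
    have "(\<lambda>n. \<xi> (shrink n f)) \<longlonglongrightarrow> \<eta> f"
      unfolding HL[OF HL_shrink[OF f]] by (rule spectrum_Au_tendsto_shrink[OF \<eta> f])
    with spectrum_Au_tendsto_shrink[OF \<xi> f] show "\<xi> f = \<eta> f" by (rule LIMSEQ_unique)
  qed
qed

lemma spectrum_HL_extends:
  fixes \<phi> :: "('a::complex_banach \<Rightarrow> complex) \<Rightarrow> complex"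
  assumes \<phi>: "\<phi> \<in> spectrum HL lip_norm"
  obtains \<xi> where "\<xi> \<in> spectrum Au sup_norm" "restrict \<xi> HL = \<phi>"
proof -
  note D = spectrumD[OF \<phi>]
  interpret sup_bounded_functional HL \<phi> 1 by (rule sup_bounded_functional_HL[OF \<phi>])
  define \<xi> where "\<xi> = (\<lambda>f\<in>Au. lim (\<lambda>n. \<phi> (shrink n f)))"
  have conv: "(\<lambda>n. \<phi> (shrink n f)) \<longlonglongrightarrow> \<xi> f" if f: "f \<in> Au" for f
    using Cauchy_of_uniform_limit[OF HL_shrink[OF f] uniform_limit_shrink[OF f]] f
    by (simp add: \<xi>_def Cauchy_convergent_iff convergent_LIMSEQ_iff)
  have ext: "\<xi> f = \<phi> f" if f: "f \<in> HL" for f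
    using tendsto_of_uniform_limit[OF HL_shrink uniform_limit_shrink f] HL_in_Au[OF f]
    by (blast intro: LIMSEQ_unique conv)
  have res: "restrict \<xi> HL = \<phi>"
    by (rule extensionalityI[OF _ D(1)]) (auto simp: ext)
  have add: "\<xi> (\<lambda>x. f x + g x) = \<xi> f + \<xi> g" if fg: "f \<in> Au" "g \<in> Au" for f g
  proof (rule LIMSEQ_unique[OF conv[OF Au_add[OF fg]]])
    show "(\<lambda>n. \<phi> (shrink n (\<lambda>x. f x + g x))) \<longlonglongrightarrow> \<xi> f + \<xi> g"
      using tendsto_add[OF conv[OF fg(1)] conv[OF fg(2)]]
      by (simp add: shrink_add D(3) HL_shrink fg)
  qed
  have cmult: "\<xi> (\<lambda>x. c * f x) = c * \<xi> f" if f: "f \<in> Au" for c f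
  proof (rule LIMSEQ_unique[OF conv[OF Au_cmult[OF f]]])
    show "(\<lambda>n. \<phi> (shrink n (\<lambda>x. c * f x))) \<longlonglongrightarrow> c * \<xi> f"
      using tendsto_mult_left[OF conv[OF f], of c] by (simp add: shrink_cmult D(4) HL_shrink f)
  qed
  have mult: "\<xi> (\<lambda>x. f x * g x) = \<xi> f * \<xi> g" if fg: "f \<in> Au" "g \<in> Au" for f g
  proof (rule LIMSEQ_unique[OF conv[OF Au_mult[OF fg]]])
    show "(\<lambda>n. \<phi> (shrink n (\<lambda>x. f x * g x))) \<longlonglongrightarrow> \<xi> f * \<xi> g"
      using tendsto_mult[OF conv[OF fg(1)] conv[OF fg(2)]]
      by (simp add: shrink_mult D(5) HL_shrink fg)
  qed
  have "cmod (\<xi> f) \<le> 1 * sup_norm f" if f: "f \<in> Au" for f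
  proof (rule field_le_epsilon)
    fix e :: real assume e: "e > 0"
    have M: "0 < sup_norm f + e" using sup_norm_nonneg[OF f] e by simp
    have "cmod (\<phi> (shrink n f)) \<le> sup_norm f + e" for n
    proof (rule spectrum_HL_contractive[OF \<phi> HL_shrink[OF f] M])
      show "cmod (shrink n f x) \<le> sup_norm f + e" if "x \<in> unit_ball" for x
        using norm_le_sup_norm[OF f shrunk_norm_le(2)[OF that, of n]] that e
        by (simp add: shrink_def)
    qed
    then show "cmod (\<xi> f) \<le> 1 * sup_norm f + e"
      using LIMSEQ_le_const2[OF tendsto_norm[OF conv[OF f]]] by simp
  qed
  moreover have "\<xi> \<noteq> (\<lambda>f\<in>Au. 0)"
  proof
    assume "\<xi> = (\<lambda>f\<in>Au. 0)"
    then have "restrict \<xi> HL = (\<lambda>f\<in>HL. 0)" by (auto simp: HL_in_Au)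
    with res D(2) show False by simp
  qed
  moreover have "\<xi> \<in> extensional Au" by (simp add: \<xi>_def)
  ultimately have "\<xi> \<in> spectrum Au sup_norm"
    unfolding spectrum_def dual_def using add cmult mult by blast
  then show thesis using res by (rule that)
qed

theorem proposition6p12:
  "bij_betw (\<lambda>\<xi>. restrict \<xi> HL)
     (spectrum (Au :: ('a::complex_banach \<Rightarrow> complex) set) sup_norm)
     (spectrum HL lip_norm)"
  unfolding bij_betw_def
proof (intro conjI inj_on_restrict_HL subset_antisym subsetI)
  fix \<phi> :: "('a \<Rightarrow> complex) \<Rightarrow> complex"
  assume "\<phi> \<in> spectrum HL lip_norm"
  then show "\<phi> \<in> (\<lambda>\<xi>. restrict \<xi> HL) ` spectrum Au sup_norm"
    using spectrum_HL_extends by (metis image_eqI)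
qed (auto intro: restrict_in_spectrum_HL)

end
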